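(* Let $J\subset\overline{1,m}$ and let $(\overline{x},\overline{\lambda},\overline{\sigma})\in\mathbb{R}^{n}\times\mathbb{R}^{m}\times\operatorname{int}I^{\ast}$ be a $J$-LKKT point of $\Xi$ such that $\overline{\sigma}_{k}=0$ for all $k\in Q$. (i) Then $\overline{\lambda}\in\Gamma_{J}$, $(\overline{\lambda},\overline{\sigma})\in T_{Q,\mathrm{col}}$, $\langle\overline{\lambda},\nabla_{\lambda}\Xi(\overline{x},\overline{\lambda},\overline{\sigma})\rangle=0$, $L(\overline{x},\overline{\lambda})=\Xi(\overline{x},\overline{\lambda},\overline{\sigma})$, $\nabla_{x}L(\overline{x},\overline{\lambda})=0$, and $f(\overline{x})=\Xi(\overline{x},\overline{\lambda},\overline{\sigma})=D(\overline{\lambda},\overline{\sigma})$. (ii) Moreover, assume that $Q_{0}^{c}\subset M_{\neq}(\overline{\lambda})$. Then $\nabla_{\lambda}L(\overline{x},\overline{\lambda})=\nabla_{\lambda}\Xi(\overline{x},\overline{\lambda},\overline{\sigma})$, $(\overline{x},\overline{\lambda})$ is a $J$-LKKT point of $L$, and $\overline{x}\in X_{J\cup Q_{0}^{c}}$. (iii) Furthermore, assume that $\overline{\lambda}_{j}>0$ for all $j\in Q_{0}^{c}$ and $G(\overline{\lambda},\overline{\sigma})\succeq0$. Then $\overline{x}\in X_{J\cup Q_{0}^{c}}\subset X_{J}\subset X_{J\cap Q}$, $(\overline{\lambda},\overline{\sigma})\in T_{Q,\mathrm{col}}^{J+}$, and $$f(\overline{x})=\inf_{x\in X_{J\cap Q}}f(x)=\Xi(\overline{x},\overline{\lambda},\overline{\sigma})=L(\overline{x},\overline{\lambda})=\sup_{(\lambda,\sigma)\in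 T_{Q,\mathrm{col}}^{J+}}D(\lambda,\sigma)=D(\overline{\lambda},\overline{\sigma});$$ moreover, if $G(\overline{\lambda},\overline{\sigma})\succ0$ then $\overline{x}$ is the unique global solution of the problem $(P_{J\cap Q})$.
   Context: Let $n,m\ge1$; $\overline{p,q}=\{p,p+1,\dots,q\}$; for $J\subset\overline{1,m}$, $J^c:=\overline{1,m}\setminus J$. $\Gamma_{sc}$ is the class of proper lower semicontinuous convex functions $h:\mathbb{R}\to\mathbb{R}\cup\{+\infty\}$ that are essentially strictly convex and essentially smooth (Legendre type): $\operatorname{int}(\operatorname{dom}h)\ne\emptyset$, $h$ is strictly convex and differentiable on $\operatorname{int}(\operatorname{dom}h)$, and $|h'(t)|\to\infty$ as $t\in\operatorname{int}(\operatorname{dom} h)$ tends to a finite boundary point of $\operatorname{dom}h$, where $\operatorname{dom}h=\{t: h(t)<\infty\}$. The conjugate is $h^*(s)=\sup_t(ts-h(t))$; $h^*\in\Gamma_{sc}$ when $h\in\Gamma_{sc}$. Data: for $k\in\overline{0,m}$, $V_k\in\Gamma_{sc}$ and $q_k,\Lambda_k:\mathbb{R}^n\to\mathbb{R}$ are quadratic functions, $q_k(x)=\tfrac12\langle x,A_kx\rangle-\langle b_k,x\rangle+c_k$, $\Lambda_k(x)=\tfrac12\langle x,C_kx\rangle-\langle d_k,x\rangle+e_k$, with $A_k,C_k$ real symmetric $n\times n$ matrices, $b_k,d_k\in\mathbb{R}^n$, $c_k,e_k\in\mathbb{R}$. Put $g_k(x):=q_k(x)+V_k(\Lambda_k(x))$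 and $f:=g_0$. $Q:=\{k\in\overline{0,m}: g_k=q_k\}$ and $Q_0:=Q\setminus\{0\}$; for $k\in Q$ one takes by convention $\Lambda_k:=0$ (so $C_k=0,d_k=0,e_k=0$) and $V_k(t):=\tfrac12t^2$. $Q_0^c=\overline{1,m}\setminus Q_0$. Problem: $X_J:=\{x\in\mathbb{R}^n: g_j(x)=0\ \forall j\in J,\ g_j(x)\le0\ \forall j\in J^c\}$ and $(P_J)$ is: minimize $f(x)$ subject to $x\in X_J$ (the same notation being used for any subset of $\overline{1,m}$ in place of $J$). Convention: $\lambda_0:=\overline\lambda_0:=1$ for $\lambda=(\lambda_1,\dots,\lambda_m)\in\mathbb{R}^m$. Let $I_k^*:=\operatorname{dom}V_k^*$, $I^*:=\prod_{k=0}^mI_k^*$, $X:=\{x\in\mathbb{R}^n:\Lambda_k(x)\in\operatorname{dom}V_k\ \forall k\in\overline{0,m}\}$, $X_0:=\{x\in\mathbb{R}^n:\Lambda_k(x)\in\operatorname{int}(\operatorname{dom}V_k)\ \forall k\in\overline{0,m}\}$. Define $L:X\times\mathbb{R}^m\to\mathbb{R}$, $L(x,\lambda)=\sum_{k=0}^m\lambda_kg_k(x)$, and $\Xi:\mathbb{R}^n\times\mathbb{R}^m\times I^*\to\mathbb{R}$, $\Xi(x,\lambda,\sigma)=\sum_{k=0}^m\lambda_k[q_k(x)+\sigma_k\Lambda_k(x)-V_k^*(\sigma_k)]$, where $\sigma=(\sigma_0,\dots,\sigma_m)$. $M_{\neq}(\lambda):=\{j\in\overline{1,m}:\lambda_j\ne0\}$;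 $\Gamma_J:=\{\lambda\in\mathbb{R}^m:\lambda_j\ge0\ \forall j\in J^c\}$. $G(\lambda,\sigma):=\sum_{k=0}^m\lambda_k(A_k+\sigma_kC_k)$, $F(\lambda,\sigma):=\sum_{k=0}^m\lambda_k(b_k+\sigma_kd_k)$. $\succeq0$, $\succ0$ mean positive semidefinite, positive definite. $T_{\mathrm{col}}:=\{(\lambda,\sigma)\in\mathbb{R}^m\times I^*: F(\lambda,\sigma)\in\operatorname{Im}G(\lambda,\sigma)\}$; $T_{Q,\mathrm{col}}:=\{(\lambda,\sigma)\in T_{\mathrm{col}}:\sigma_k=0\ \forall k\in Q\}$; $T_{Q,\mathrm{col}}^{J+}:=\{(\lambda,\sigma)\in T_{Q,\mathrm{col}}:\lambda\in\Gamma_{J\cap Q},\ G(\lambda,\sigma)\succeq0\}$. $D:T_{\mathrm{col}}\to\mathbb{R}$, $D(\lambda,\sigma):=\Xi(x,\lambda,\sigma)$ for any $x$ with $G(\lambda,\sigma)x=F(\lambda,\sigma)$ (the value does not depend on the choice of $x$). $(\overline x,\overline\lambda,\overline\sigma)\in\mathbb{R}^n\times\mathbb{R}^m\times\operatorname{int}I^*$ is a $J$-LKKT point of $\Xi$ if $\nabla_x\Xi=0$, $\nabla_\sigma\Xi=0$ at it, for all $j\in J^c$: $\overline\lambda_j\ge0$, $\frac{\partial\Xi}{\partial\lambda_j}\le0$ and $\overline\lambda_j\frac{\partial\Xi}{\partial\lambda_j}=0$ at it, and for all $j\in J$: $\frac{\partial\Xi}{\partial\lambda_j}=0$ at it. $(\overline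 x,\overline\lambda)\in X_0\times\mathbb{R}^m$ is a $J$-LKKT point of $L$ if $\nabla_xL(\overline x,\overline\lambda)=0$, for all $j\in J^c$: $\overline\lambda_j\ge0$, $\frac{\partial L}{\partial\lambda_j}(\overline x,\overline\lambda)\le0$, $\overline\lambda_j\frac{\partial L}{\partial\lambda_j}(\overline x,\overline\lambda)=0$, and for all $j\in J$: $\frac{\partial L}{\partial\lambda_j}(\overline x,\overline\lambda)=0$. *)

theory Defs
  imports "HOL-Analysis.Analysis"
begin

section \<open>Extended-real-valued convex functions on the line\<close>

definition edom :: "(real \<Rightarrow> ereal) \<Rightarrow> real set" where
  "edom h = {t. h t < \<infinity>}"

definition proper_fun :: "(real \<Rightarrow> ereal) \<Rightarrow> bool" where
  "proper_fun h \<longleftrightarrow> (\<forall>t. h t \<noteq> -\<infinity>) \<and> edom h \<noteq> {}"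

definition lsc_fun :: "(real \<Rightarrow> ereal) \<Rightarrow> bool" where
  "lsc_fun h \<longleftrightarrow> (\<forall>t. h t \<le> Liminf (at t) h)"

definition econvex :: "(real \<Rightarrow> ereal) \<Rightarrow> bool" where
  "econvex h \<longleftrightarrow> (\<forall>s t u. 0 \<le> u \<longrightarrow> u \<le> 1 \<longrightarrow>
     h (u * s + (1 - u) * t) \<le> ereal u * h s + ereal (1 - u) * h t)"

definition strictly_econvex_on :: "real set \<Rightarrow> (real \<Rightarrow> ereal) \<Rightarrow> bool" where
  "strictly_econvex_on S h \<longleftrightarrow> (\<forall>s\<in>S. \<forall>t\<in>S. \<forall>u. s \<noteq> t \<longrightarrow> 0 < u \<longrightarrow> u < 1 \<longrightarrow>
     h (u * s + (1 - u) * t) < ereal u * h s + ereal (1 - u) * h t)"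

text \<open>Legendre type.  A frontier point of a subset of the line is automatically finite.\<close>

definition Gamma_sc :: "(real \<Rightarrow> ereal) set" where
  "Gamma_sc = {h. proper_fun h \<and> lsc_fun h \<and> econvex h \<and>
     interior (edom h) \<noteq> {} \<and>
     strictly_econvex_on (interior (edom h)) h \<and>
     (\<forall>t\<in>interior (edom h). (\<lambda>s. real_of_ereal (h s)) differentiable at t) \<and>
     (\<forall>a\<in>frontier (edom h).
        filterlim (\<lambda>t. \<bar>deriv (\<lambda>s. real_of_ereal (h s)) t\<bar>) at_top
          (at a within interior (edom h)))}"

definition conjugate_fun :: "(real \<Rightarrow> ereal) \<Rightarrow> real \<Rightarrow> ereal" where
  "conjugate_fun h s = (SUP t. ereal (t * s) - h t)"


section \<open>Semidefiniteness, quadratic functions, partial derivatives\<close>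

definition pos_semidef :: "real^'n^'n \<Rightarrow> bool" where
  "pos_semidef M \<longleftrightarrow> (\<forall>x. 0 \<le> x \<bullet> (M *v x))"

definition pos_def :: "real^'n^'n \<Rightarrow> bool" where
  "pos_def M \<longleftrightarrow> (\<forall>x. x \<noteq> 0 \<longrightarrow> 0 < x \<bullet> (M *v x))"

definition quad_fun :: "real^'n^'n \<Rightarrow> real^'n \<Rightarrow> real \<Rightarrow> real^'n \<Rightarrow> real" where
  "quad_fun M v r x = 1/2 * (x \<bullet> (M *v x)) - v \<bullet> x + r"

definition partial_deriv :: "(real^'m \<Rightarrow> real) \<Rightarrow> real^'m \<Rightarrow> 'm \<Rightarrow> real" where
  "partial_deriv \<phi> v j = deriv (\<lambda>t. \<phi> (v + t *\<^sub>R axis j 1)) 0"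


section \<open>Problem data\<close>

text \<open>
  Constraints are indexed by a finite type \<open>'m\<close> (so \<open>m = CARD('m) \<ge> 1\<close>), and the extended
  index range \<open>0, 1, ..., m\<close> is \<open>'m option\<close>, with \<open>None\<close> in the role of the objective index 0.
\<close>

record ('n::finite, 'm::finite) cd_data =
  Amat :: "'m option \<Rightarrow> real^'n^'n"
  bvec :: "'m option \<Rightarrow> real^'n"
  ccst :: "'m option \<Rightarrow> real"
  Cmat :: "'m option \<Rightarrow> real^'n^'n"
  dvec :: "'m option \<Rightarrow> real^'n"
  ecst :: "'m option \<Rightarrow> real"
  Vfun :: "'m option \<Rightarrow> real \<Rightarrow> ereal"

definition qfun :: "('n::finite, 'm::finite) cd_data \<Rightarrow> 'm option \<Rightarrow> real^'n \<Rightarrow> real" where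
  "qfun P k = quad_fun (Amat P k) (bvec P k) (ccst P k)"

definition Lamfun :: "('n::finite, 'm::finite) cd_data \<Rightarrow> 'm option \<Rightarrow> real^'n \<Rightarrow> real" where
  "Lamfun P k = quad_fun (Cmat P k) (dvec P k) (ecst P k)"

definition gfun :: "('n::finite, 'm::finite) cd_data \<Rightarrow> 'm option \<Rightarrow> real^'n \<Rightarrow> ereal" where
  "gfun P k x = ereal (qfun P k x) + Vfun P k (Lamfun P k x)"

definition ffun :: "('n::finite, 'm::finite) cd_data \<Rightarrow> real^'n \<Rightarrow> ereal" where
  "ffun P = gfun P None"

definition Qset :: "('n::finite, 'm::finite) cd_data \<Rightarrow> 'm option set" where
  "Qset P = {k. \<forall>x. gfun P k x = ereal (qfun P k x)}"

definition Q0set :: "('n::finite, 'm::finite) cd_data \<Rightarrow> 'm set" where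
  "Q0set P = {j. Some j \<in> Qset P}"

definition admissible :: "('n::finite, 'm::finite) cd_data \<Rightarrow> bool" where
  "admissible P \<longleftrightarrow>
     (\<forall>k. Vfun P k \<in> Gamma_sc) \<and>
     (\<forall>k. transpose (Amat P k) = Amat P k) \<and>
     (\<forall>k. transpose (Cmat P k) = Cmat P k) \<and>
     (\<forall>k\<in>Qset P. Cmat P k = 0 \<and> dvec P k = 0 \<and> ecst P k = 0 \<and>
        Vfun P k = (\<lambda>t. ereal (t\<^sup>2 / 2)))"

definition XJ :: "('n::finite, 'm::finite) cd_data \<Rightarrow> 'm set \<Rightarrow> (real^'n) set" where
  "XJ P J = {x. (\<forall>j\<in>J. gfun P (Some j) x = 0) \<and> (\<forall>j\<in>-J. gfun P (Some j) x \<le> 0)}"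

definition global_solution ::
    "('n::finite, 'm::finite) cd_data \<Rightarrow> 'm set \<Rightarrow> real^'n \<Rightarrow> bool" where
  "global_solution P J x \<longleftrightarrow> is_arg_min (ffun P) (\<lambda>y. y \<in> XJ P J) x"

definition X0set :: "('n::finite, 'm::finite) cd_data \<Rightarrow> (real^'n) set" where
  "X0set P = {x. \<forall>k. Lamfun P k x \<in> interior (edom (Vfun P k))}"

definition Istar :: "('n::finite, 'm::finite) cd_data \<Rightarrow> (real^('m option)) set" where
  "Istar P = {\<sigma>. \<forall>k. \<sigma> $ k \<in> edom (conjugate_fun (Vfun P k))}"


section \<open>Lagrangians, dual objective, LKKT points\<close>

definition lam :: "real^'m \<Rightarrow> 'm option \<Rightarrow> real" where
  "lam \<mu> k = (case k of None \<Rightarrow> 1 | Some j \<Rightarrow> \<mu> $ j)"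

text \<open>
  Where \<open>gfun P k x = \<infinity>\<close>, \<open>real_of_ereal\<close> returns 0.  So a summand with zero multiplier
  contributes 0 even there (the convention \<open>0 \<cdot> \<infinity> = 0\<close>), and the sum is the ordinary
  Lagrangian wherever \<open>Lamfun P k x \<in> edom (Vfun P k)\<close> for all \<open>k\<close>.
\<close>

definition Lfun :: "('n::finite, 'm::finite) cd_data \<Rightarrow> real^'n \<Rightarrow> real^'m \<Rightarrow> real" where
  "Lfun P x \<mu> = (\<Sum>k\<in>UNIV. lam \<mu> k * real_of_ereal (gfun P k x))"

text \<open>Meaningful for \<open>\<sigma> \<in> Istar P\<close>, where the conjugates are finite.\<close>

definition Xi :: "('n::finite, 'm::finite) cd_data \<Rightarrow>
    real^'n \<Rightarrow> real^'m \<Rightarrow> real^('m option) \<Rightarrow> real" where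
  "Xi P x \<mu> \<sigma> = (\<Sum>k\<in>UNIV. lam \<mu> k *
     (qfun P k x + \<sigma> $ k * Lamfun P k x - real_of_ereal (conjugate_fun (Vfun P k) (\<sigma> $ k))))"

definition Mneq :: "real^'m \<Rightarrow> 'm set" where
  "Mneq \<mu> = {j. \<mu> $ j \<noteq> 0}"

definition GammaJ :: "'m set \<Rightarrow> (real^'m) set" where
  "GammaJ J = {\<mu>. \<forall>j\<in>-J. 0 \<le> \<mu> $ j}"

definition Gmat :: "('n::finite, 'm::finite) cd_data \<Rightarrow>
    real^'m \<Rightarrow> real^('m option) \<Rightarrow> real^'n^'n" where
  "Gmat P \<mu> \<sigma> = (\<Sum>k\<in>UNIV. lam \<mu> k *\<^sub>R (Amat P k + (\<sigma> $ k) *\<^sub>R Cmat P k))"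

definition Fvec :: "('n::finite, 'm::finite) cd_data \<Rightarrow>
    real^'m \<Rightarrow> real^('m option) \<Rightarrow> real^'n" where
  "Fvec P \<mu> \<sigma> = (\<Sum>k\<in>UNIV. lam \<mu> k *\<^sub>R (bvec P k + (\<sigma> $ k) *\<^sub>R dvec P k))"

definition Tcol :: "('n::finite, 'm::finite) cd_data \<Rightarrow> ((real^'m) \<times> (real^('m option))) set" where
  "Tcol P = {(\<mu>, \<sigma>). \<sigma> \<in> Istar P \<and> Fvec P \<mu> \<sigma> \<in> range ((*v) (Gmat P \<mu> \<sigma>))}"

definition TQcol :: "('n::finite, 'm::finite) cd_data \<Rightarrow> ((real^'m) \<times> (real^('m option))) set" where
  "TQcol P = {(\<mu>, \<sigma>). (\<mu>, \<sigma>) \<in> Tcol P \<and> (\<forall>k\<in>Qset P. \<sigma> $ k = 0)}"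

definition TQcolplus :: "('n::finite, 'm::finite) cd_data \<Rightarrow> 'm set \<Rightarrow>
    ((real^'m) \<times> (real^('m option))) set" where
  "TQcolplus P J = {(\<mu>, \<sigma>). (\<mu>, \<sigma>) \<in> TQcol P \<and> \<mu> \<in> GammaJ (J \<inter> Q0set P) \<and>
     pos_semidef (Gmat P \<mu> \<sigma>)}"

text \<open>
  On \<open>Tcol P\<close>, with the matrices of the data symmetric, the value does not depend on the
  solution chosen, since \<open>Xi P x \<mu> \<sigma>\<close> is a quadratic function of \<open>x\<close> with Hessian
  \<open>Gmat P \<mu> \<sigma>\<close> and linear term \<open>- Fvec P \<mu> \<sigma>\<close>.
\<close>

definition Dfun :: "('n::finite, 'm::finite) cd_data \<Rightarrow> real^'m \<Rightarrow> real^('m option) \<Rightarrow> real" where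
  "Dfun P \<mu> \<sigma> = Xi P (SOME x. Gmat P \<mu> \<sigma> *v x = Fvec P \<mu> \<sigma>) \<mu> \<sigma>"

definition LKKT_Xi :: "('n::finite, 'm::finite) cd_data \<Rightarrow> 'm set \<Rightarrow>
    real^'n \<Rightarrow> real^'m \<Rightarrow> real^('m option) \<Rightarrow> bool" where
  "LKKT_Xi P J x \<mu> \<sigma> \<longleftrightarrow>
     \<sigma> \<in> interior (Istar P) \<and>
     GDERIV (\<lambda>y. Xi P y \<mu> \<sigma>) x :> 0 \<and>
     GDERIV (\<lambda>s. Xi P x \<mu> s) \<sigma> :> 0 \<and>
     (\<forall>j\<in>-J. 0 \<le> \<mu> $ j \<and>
        partial_deriv (\<lambda>l. Xi P x l \<sigma>) \<mu> j \<le> 0 \<and>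
        \<mu> $ j * partial_deriv (\<lambda>l. Xi P x l \<sigma>) \<mu> j = 0) \<and>
     (\<forall>j\<in>J. partial_deriv (\<lambda>l. Xi P x l \<sigma>) \<mu> j = 0)"

definition LKKT_L :: "('n::finite, 'm::finite) cd_data \<Rightarrow> 'm set \<Rightarrow>
    real^'n \<Rightarrow> real^'m \<Rightarrow> bool" where
  "LKKT_L P J x \<mu> \<longleftrightarrow>
     x \<in> X0set P \<and>
     GDERIV (\<lambda>y. Lfun P y \<mu>) x :> 0 \<and>
     (\<forall>j\<in>-J. 0 \<le> \<mu> $ j \<and>
        partial_deriv (\<lambda>l. Lfun P x l) \<mu> j \<le> 0 \<and>
        \<mu> $ j * partial_deriv (\<lambda>l. Lfun P x l) \<mu> j = 0) \<and>
     (\<forall>j\<in>J. partial_deriv (\<lambda>l. Lfun P x l) \<mu> j = 0)"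

end

theory Submission
  imports Defs
begin

text \<open>
  Stationarity of \<open>Xi\<close> in \<open>\<sigma>\<close> says that
  \<open>\<lambda>\<^sub>k (\<Lambda>\<^sub>k(x) - (V\<^sub>k\<^sup>*)'(\<sigma>\<^sub>k)) = 0\<close> for every \<open>k\<close>.  Where \<open>\<lambda>\<^sub>k \<noteq> 0\<close>, the derivative of the
  conjugate at \<open>\<sigma>\<^sub>k\<close> is therefore \<open>\<Lambda>\<^sub>k(x)\<close>, and since \<open>V\<^sub>k\<close> is of Legendre type this reverses
  (\<open>Legendre_duality\<close>): \<open>\<Lambda>\<^sub>k(x)\<close> is interior to the domain of \<open>V\<^sub>k\<close>, the derivative of \<open>V\<^sub>k\<close> there is
  \<open>\<sigma>\<^sub>k\<close>, and equality holds in the Fenchel--Young inequality.  So \<open>q\<^sub>k + \<sigma>\<^sub>k \<Lambda>\<^sub>k - V\<^sub>k\<^sup>*(\<sigma>\<^sub>k)\<close> and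
  \<open>g\<^sub>k\<close> have the same value and the same gradient in \<open>x\<close> at the given point.  The same is true for
  \<open>k \<in> Q\<close>, where both functions are \<open>q\<^sub>k\<close>, and a summand with \<open>\<lambda>\<^sub>k = 0\<close> contributes to neither \<open>L\<close>
  nor \<open>Xi\<close>.  This transfers stationarity and complementary slackness from \<open>Xi\<close> to \<open>L\<close>, and
  complementary slackness reduces the common value to \<open>f(x)\<close>.  Nothing is learned about \<open>g\<^sub>j(x)\<close> when
  \<open>j \<notin> Q\<close> and \<open>\<lambda>\<^sub>j = 0\<close>; excluding this case gives feasibility, with \<open>g\<^sub>j(x) = 0\<close> for all \<open>j \<notin> Q\<close> by
  complementary slackness.

  In \<open>x\<close>, \<open>Xi\<close> is a quadratic function with Hessian \<open>G(\<lambda>,\<sigma>)\<close> and linear term \<open>-F(\<lambda>,\<sigma>)\<close>, so its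
  stationary points solve \<open>G x = F\<close> and share one value, that of \<open>D\<close>
  (\<open>Xi_eq_quad_fun\<close>, \<open>Dfun_eq_Xi\<close>); if \<open>G\<close> is positive semidefinite they minimise \<open>Xi\<close> in \<open>x\<close>.

  The optimality statements come from weak duality.  If \<open>\<sigma>\<close> vanishes on \<open>Q\<close> and \<open>\<lambda>\<^sub>j \<ge> 0\<close> for
  \<open>j \<notin> J \<inter> Q\<close>, the Fenchel--Young inequality bounds each summand of \<open>Xi\<close> by the one of \<open>L\<close>, with
  equality on \<open>Q\<close>, where the multiplier may be negative.  Hence \<open>D \<le> Xi \<le> f\<close> at every point
  feasible for \<open>J \<inter> Q\<close> (\<open>Xi_le_ffun\<close>, \<open>weak_duality\<close>).  The given point attains equality
  throughout.  If \<open>G(\<lambda>,\<sigma>)\<close> is positive definite then \<open>Xi\<close> is strictly larger away from its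
  stationary point, hence so is \<open>f\<close> on the feasible set.
\<close>

section \<open>Conjugates of Legendre functions on the line\<close>

lemma Gamma_sc_proper: "h \<in> Gamma_sc \<Longrightarrow> proper_fun h"
  by (simp add: Gamma_sc_def)

lemma proper_ereal_real:
  assumes "proper_fun h" "t \<in> edom h"
  shows "ereal (real_of_ereal (h t)) = h t"
  using assms unfolding proper_fun_def edom_def
  by (cases "h t") (auto simp: less_top)

lemma conjugate_ereal_real:
  assumes "proper_fun h" "s \<in> edom (conjugate_fun h)"
  shows "ereal (real_of_ereal (conjugate_fun h s)) = conjugate_fun h s"
proof -
  obtain t where t: "t \<in> edom h" using assms(1) by (auto simp: proper_fun_def)
  have "ereal (t * s) - h t \<le> conjugate_fun h s"
    unfolding conjugate_fun_def by (rule SUP_upper) simp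
  moreover have "ereal (t * s) - h t = ereal (t * s - real_of_ereal (h t))"
    by (metis proper_ereal_real[OF assms(1) t] ereal_minus(1))
  ultimately have "conjugate_fun h s \<noteq> -\<infinity>" by auto
  then show ?thesis using assms(2) unfolding edom_def
    by (cases "conjugate_fun h s") auto
qed

lemma Fenchel_Young:
  assumes "proper_fun h" "s \<in> edom (conjugate_fun h)"
  shows "ereal (t * s - real_of_ereal (conjugate_fun h s)) \<le> h t"
proof -
  have le: "ereal (t * s) - h t \<le> ereal (real_of_ereal (conjugate_fun h s))"
    unfolding conjugate_ereal_real[OF assms] by (simp add: conjugate_fun_def) (rule SUP_upper, simp)
  moreover have "h t \<noteq> -\<infinity>" using assms(1) by (simp add: proper_fun_def)
  ultimately show ?thesis by (cases "h t") auto
qed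

text \<open>
  With \<open>s \<plusminus> e\<close> in the domain of the conjugate, the Fenchel--Young inequality at these two points
  makes \<open>h u - u s\<close> grow at least like \<open>e \<bar>u\<bar>\<close>.  A maximising sequence for \<open>u s - h u\<close> is thus
  bounded, and lower semicontinuity makes every limit point a maximiser.
\<close>

lemma conjugate_attained:
  assumes "proper_fun h" "lsc_fun h" and s: "s \<in> interior (edom (conjugate_fun h))"
  obtains u where "h u = ereal (u * s - real_of_ereal (conjugate_fun h s))"
proof -
  define c where "c s' = real_of_ereal (conjugate_fun h s')" for s'
  have FY: "ereal (u * s' - c s') \<le> h u" if "s' \<in> edom (conjugate_fun h)" for u s'
    unfolding c_def by (rule Fenchel_Young[OF assms(1) that])
  have sd: "s \<in> edom (conjugate_fun h)" using s interior_subset by blast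
  obtain e where e: "e > 0" "cball s e \<subseteq> edom (conjugate_fun h)"
    using s by (meson mem_interior_cball)
  have ends: "s + e \<in> edom (conjugate_fun h)" "s - e \<in> edom (conjugate_fun h)"
    using e by (auto intro!: subsetD[OF e(2)] simp: dist_real_def)
  have "\<exists>u. ereal (c s - 1 / real (Suc n)) < ereal (u * s) - h u" for n
  proof -
    have "ereal (c s - 1 / real (Suc n)) < ereal (c s)" by simp
    also have "ereal (c s) = (SUP t. ereal (t * s) - h t)"
      unfolding c_def conjugate_ereal_real[OF assms(1) sd] by (rule conjugate_fun_def)
    finally show ?thesis by (simp add: less_SUP_iff)
  qed
  then obtain w where w: "\<And>n. ereal (c s - 1 / real (Suc n)) < ereal (w n * s) - h (w n)"
    by metis
  have hw: "h (w n) < ereal (w n * s - c s + 1 / real (Suc n))" for n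
    using w[of n] assms(1) by (cases "h (w n)") (auto simp: proper_fun_def)
  define R where "R = (\<bar>c (s + e)\<bar> + \<bar>c (s - e)\<bar> + \<bar>c s\<bar> + 1) / e"
  have "\<bar>w n\<bar> \<le> R" for n
  proof -
    have a: "ereal (w n * (s + e) - c (s + e)) < ereal (w n * s - c s + 1 / real (Suc n))"
      using FY[OF ends(1)] hw[of n] by (rule le_less_trans)
    have b: "ereal (w n * (s - e) - c (s - e)) < ereal (w n * s - c s + 1 / real (Suc n))"
      using FY[OF ends(2)] hw[of n] by (rule le_less_trans)
    have one: "1 / real (Suc n) \<le> 1" by simp
    have "w n * e \<le> \<bar>c (s + e)\<bar> + \<bar>c (s - e)\<bar> + \<bar>c s\<bar> + 1"
         "- (w n * e) \<le> \<bar>c (s + e)\<bar> + \<bar>c (s - e)\<bar> + \<bar>c s\<bar> + 1"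
      using a b one unfolding less_ereal.simps distrib_left right_diff_distrib by linarith+
    then have "\<bar>w n\<bar> * e \<le> \<bar>c (s + e)\<bar> + \<bar>c (s - e)\<bar> + \<bar>c s\<bar> + 1"
      using e(1) by (simp add: abs_if)
    then show ?thesis unfolding R_def using e(1) by (simp add: le_divide_eq)
  qed
  then have "\<forall>n. w n \<in> cball 0 R" by simp
  then obtain u r where r: "strict_mono r" "(w \<circ> r) \<longlonglongrightarrow> u"
    using compact_cball[of "0::real" R] unfolding compact_def by metis
  have "h u \<le> ereal (u * s - c s)"
  proof (rule ccontr)
    assume "\<not> ?thesis"
    then obtain q where q: "u * s - c s < q" "ereal q < h u"
      using ereal_dense2[of "ereal (u * s - c s)" "h u"] by (auto simp: not_le)
    have "ereal q < Liminf (at u) h"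
      using q(2) assms(2) unfolding lsc_fun_def by (meson less_le_trans)
    then have "\<forall>\<^sub>F v in at u. ereal q < h v" by (rule less_LiminfD)
    then have "\<forall>\<^sub>F v in nhds u. ereal q < h v"
      using q(2) by (auto simp: eventually_nhds_conv_at)
    then have "\<forall>\<^sub>F n in sequentially. ereal q < h ((w \<circ> r) n)"
      using r(2) by (auto simp: filterlim_iff)
    then have ev: "\<forall>\<^sub>F n in sequentially.
        q \<le> (w \<circ> r) n * s - c s + 1 / real (Suc (r n))"
    proof eventually_elim
      case (elim n)
      then have "ereal q < ereal (w (r n) * s - c s + 1 / real (Suc (r n)))"
        using less_trans[OF _ hw[of "r n"]] by (simp only: o_apply)
      then show ?case by simp
    qed
    have "(\<lambda>n. 1 / real (Suc (r n))) \<longlonglongrightarrow> 0"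
      using LIMSEQ_subseq_LIMSEQ[OF LIMSEQ_Suc[OF lim_1_over_n] r(1)] by (simp add: o_def)
    then have "(\<lambda>n. (w \<circ> r) n * s - c s + 1 / real (Suc (r n))) \<longlonglongrightarrow> u * s - c s + 0"
      by (intro tendsto_intros r(2))
    then have "q \<le> u * s - c s + 0"
      using ev by (intro tendsto_lowerbound) auto
    with q(1) show False by simp
  qed
  with FY[OF sd, of u] have "h u = ereal (u * s - c s)" by (rule antisym[rotated])
  then show ?thesis using that unfolding c_def by blast
qed

text \<open>
  A maximiser \<open>u\<close> of \<open>t s - h t\<close> is a subgradient of the conjugate at \<open>s\<close>, and a derivative is the
  only subgradient.
\<close>

lemma conjugate_deriv_attains:
  assumes "proper_fun h" "lsc_fun h" and s: "s \<in> interior (edom (conjugate_fun h))"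
    and D: "((\<lambda>r. real_of_ereal (conjugate_fun h r)) has_real_derivative t) (at s)"
  shows "h t = ereal (t * s - real_of_ereal (conjugate_fun h s))"
proof -
  obtain u where u: "h u = ereal (u * s - real_of_ereal (conjugate_fun h s))"
    using conjugate_attained[OF assms(1-3)] by blast
  obtain e where e: "e > 0" "ball s e \<subseteq> edom (conjugate_fun h)"
    using s by (meson mem_interior)
  let ?p = "\<lambda>r. real_of_ereal (conjugate_fun h r) - u * r"
  have "?p s \<le> ?p r" if "\<bar>s - r\<bar> < e" for r
  proof -
    have "r \<in> edom (conjugate_fun h)"
      using e that by (auto simp: dist_real_def)
    from Fenchel_Young[OF assms(1) this, of u] show ?thesis by (simp add: u)
  qed
  moreover have "(?p has_real_derivative (t - u)) (at s)"
    by (auto intro!: derivative_eq_intros D)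
  ultimately have "t - u = 0"
    using e(1) by (intro DERIV_local_min[of ?p _ s e]) auto
  with u show ?thesis by simp
qed

lemma econvex_imp_convex_edom:
  assumes "econvex h"
  shows "convex (edom h)"
proof (rule convexI)
  fix x y u v :: real
  assume a: "x \<in> edom h" "y \<in> edom h" "0 \<le> u" "0 \<le> v" "u + v = 1"
  then have v: "v = 1 - u" by simp
  have "h (u * x + (1 - u) * y) \<le> ereal u * h x + ereal (1 - u) * h y"
    using assms a unfolding econvex_def by auto
  also have "\<dots> < \<infinity>"
    using a v by (cases "h x"; cases "h y") (auto simp: edom_def)
  finally show "u *\<^sub>R x + v *\<^sub>R y \<in> edom h" by (simp add: edom_def v)
qed

lemma econvex_imp_convex_on:
  assumes "proper_fun h" "econvex h"
  shows "convex_on (edom h) (\<lambda>t. real_of_ereal (h t))"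
proof (rule convex_onI)
  fix t x y :: real
  assume a: "0 < t" "t < 1" "x \<in> edom h" "y \<in> edom h"
  have m: "(1 - t) * x + t * y \<in> edom h"
    using convexD[OF econvex_imp_convex_edom[OF assms(2)] a(3,4), of "1 - t" t] a by simp
  have "h ((1 - t) * x + (1 - (1 - t)) * y) \<le> ereal (1 - t) * h x + ereal (1 - (1 - t)) * h y"
    using assms(2) a unfolding econvex_def by (smt (verit))
  then have "h ((1 - t) * x + t * y) \<le> ereal (1 - t) * h x + ereal t * h y" by simp
  then have "ereal (real_of_ereal (h ((1 - t) * x + t * y)))
      \<le> ereal ((1 - t) * real_of_ereal (h x) + t * real_of_ereal (h y))"
    using proper_ereal_real[OF assms(1)] m a(3,4)
    by (metis plus_ereal.simps(1) times_ereal.simps(1))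
  then show "real_of_ereal (h ((1 - t) *\<^sub>R x + t *\<^sub>R y))
      \<le> (1 - t) * real_of_ereal (h x) + t * real_of_ereal (h y)" by simp
qed (rule econvex_imp_convex_edom[OF assms(2)])

text \<open>
  Essential smoothness excludes subgradients at the boundary.  On the segment from a boundary
  point \<open>t\<close> towards an interior point \<open>u0\<close>, monotonicity of difference quotients confines \<open>h'\<close>
  between the subgradient \<open>s\<close> at \<open>t\<close> and \<open>h'(u0)\<close>, so it cannot blow up at \<open>t\<close>.
\<close>

lemma Gamma_sc_subgradient_interior:
  assumes h: "h \<in> Gamma_sc" and t: "t \<in> edom h"
    and sub: "\<And>v. v \<in> edom h \<Longrightarrow>
      real_of_ereal (h t) + s * (v - t) \<le> real_of_ereal (h v)"
  shows "t \<in> interior (edom h)"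
proof (rule ccontr)
  let ?H = "\<lambda>v. real_of_ereal (h v)" and ?S = "edom h"
  assume nt: "t \<notin> interior ?S"
  have proper: "proper_fun h" and conv: "econvex h"
    using h by (auto simp: Gamma_sc_def)
  have cS: "convex ?S" by (rule econvex_imp_convex_edom[OF conv])
  have cH: "convex_on ?S ?H" by (rule econvex_imp_convex_on[OF proper conv])
  have tangent: "?H v \<ge> ?H u + deriv ?H u * (v - u)" if "u \<in> interior ?S" "v \<in> ?S" for u v
  proof -
    have "?H differentiable at u" using h that(1) by (auto simp: Gamma_sc_def)
    then have "(?H has_real_derivative deriv ?H u) (at u within ?S)"
      by (metis DERIV_deriv_iff_real_differentiable has_field_derivative_at_within)
    from convex_on_imp_above_tangent[OF cH convex_connected[OF cS] that this]
    show ?thesis by (simp add: algebra_simps)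
  qed
  have "t \<in> frontier ?S" using t nt closure_subset by (auto simp: frontier_def)
  then have lim: "filterlim (\<lambda>v. \<bar>deriv ?H v\<bar>) at_top (at t within interior ?S)"
    using h by (auto simp: Gamma_sc_def)
  obtain u0 where u0: "u0 \<in> interior ?S" using h by (auto simp: Gamma_sc_def)
  then have ne: "u0 \<noteq> t" using nt by auto
  define B where "B = max \<bar>s\<bar> \<bar>deriv ?H u0\<bar>"
  have "\<forall>\<^sub>F v in at t within interior ?S. B < \<bar>deriv ?H v\<bar>"
    using lim by (simp add: filterlim_at_top_dense)
  then obtain d where d: "d > 0"
      "\<And>v. v \<in> interior ?S \<Longrightarrow> v \<noteq> t \<Longrightarrow> dist v t < d \<Longrightarrow> B < \<bar>deriv ?H v\<bar>"
    by (auto simp: eventually_at)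
  \<comment> \<open>Small enough for \<open>t + e (u0 - t)\<close> to lie within \<open>d\<close> of \<open>t\<close> and strictly before \<open>u0\<close>.\<close>
  define e where "e = min (1/2) (d / (2 * \<bar>u0 - t\<bar>))"
  have e: "0 < e" "e < 1" "e * \<bar>u0 - t\<bar> < d"
  proof -
    show "0 < e" "e < 1" using d(1) ne by (auto simp: e_def)
    have "e * \<bar>u0 - t\<bar> \<le> d / (2 * \<bar>u0 - t\<bar>) * \<bar>u0 - t\<bar>"
      by (intro mult_right_mono) (auto simp: e_def)
    also have "\<dots> < d" using ne d(1) by (simp add: field_simps)
    finally show "e * \<bar>u0 - t\<bar> < d" .
  qed
  define u where "u = t - e *\<^sub>R (t - u0)"
  have u: "u \<in> interior ?S" unfolding u_def
    by (rule mem_interior_convex_shrink[OF cS u0 t]) (use e in auto)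
  have ut: "u - t = e * (u0 - t)" and uu: "u - u0 = - ((1 - e) * (u0 - t))"
    by (simp_all add: u_def algebra_simps)
  have uS: "u \<in> ?S" "u0 \<in> ?S" using u u0 interior_subset by auto
  have big: "B < \<bar>deriv ?H u\<bar>"
    using u ut e ne by (intro d(2)) (auto simp: dist_real_def abs_mult)
  have "0 \<le> (deriv ?H u - s) * (u - t)"
    using tangent[OF u t] sub[OF uS(1)] by (simp add: algebra_simps)
  then have 1: "0 \<le> (deriv ?H u - s) * (u0 - t)"
    using e(1) unfolding ut by (simp add: mult.left_commute zero_le_mult_iff[of e])
  have "0 \<le> (deriv ?H u - deriv ?H u0) * (u - u0)"
    using tangent[OF u uS(2)] tangent[OF u0 uS(1)] by (simp add: algebra_simps)
  then have 2: "(deriv ?H u - deriv ?H u0) * (u0 - t) \<le> 0"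
    using e(2) unfolding uu by (simp add: mult.left_commute mult_le_0_iff[of "1 - e"])
  \<comment> \<open>The sign of \<open>u0 - t\<close> decides which of \<open>s\<close> and \<open>deriv ?H u0\<close> is the upper bound.\<close>
  have "\<bar>deriv ?H u\<bar> \<le> B"
  proof (cases "u0 > t")
    case True
    with 1 2 show ?thesis unfolding B_def by (auto simp: zero_le_mult_iff mult_le_0_iff)
  next
    case False
    with ne 1 2 show ?thesis unfolding B_def by (auto simp: zero_le_mult_iff mult_le_0_iff)
  qed
  with big show False by simp
qed

text \<open>
  Equality in the Fenchel--Young inequality at \<open>(t, s)\<close> makes \<open>s\<close> a subgradient of \<open>h\<close> at \<open>t\<close>;
  then \<open>t\<close> is interior, \<open>h\<close> is differentiable there, and the derivative is the only subgradient.
\<close>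

lemma Legendre_duality:
  assumes h: "h \<in> Gamma_sc" and s: "s \<in> interior (edom (conjugate_fun h))"
    and D: "((\<lambda>r. real_of_ereal (conjugate_fun h r)) has_real_derivative t) (at s)"
  shows "h t = ereal (t * s - real_of_ereal (conjugate_fun h s))"
    and "t \<in> interior (edom h)"
    and "((\<lambda>v. real_of_ereal (h v)) has_real_derivative s) (at t)"
proof -
  let ?H = "\<lambda>v. real_of_ereal (h v)"
  have proper: "proper_fun h" and lsc: "lsc_fun h" using h by (auto simp: Gamma_sc_def)
  have sd: "s \<in> edom (conjugate_fun h)" using s interior_subset by blast
  show ht: "h t = ereal (t * s - real_of_ereal (conjugate_fun h s))"
    by (rule conjugate_deriv_attains[OF proper lsc s D])
  have sub: "?H t + s * (v - t) \<le> ?H v" if "v \<in> edom h" for v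
  proof -
    have "ereal (v * s - real_of_ereal (conjugate_fun h s)) \<le> ereal (?H v)"
      unfolding proper_ereal_real[OF proper that] by (rule Fenchel_Young[OF proper sd])
    then show ?thesis by (simp add: ht algebra_simps)
  qed
  have "t \<in> edom h" by (simp add: edom_def ht)
  then show int: "t \<in> interior (edom h)"
    using Gamma_sc_subgradient_interior[OF h _ sub] by blast
  then obtain e where e: "e > 0" "ball t e \<subseteq> edom h" by (meson mem_interior)
  have "?H differentiable at t" using h int by (auto simp: Gamma_sc_def)
  then obtain d where d: "(?H has_real_derivative d) (at t)"
    using real_differentiable_def by blast
  have "((\<lambda>v. ?H v - s * v) has_real_derivative (d - s)) (at t)"
    by (auto intro!: derivative_eq_intros d)
  moreover have "?H t - s * t \<le> ?H v - s * v" if "\<bar>t - v\<bar> < e" for v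
  proof -
    have "v \<in> edom h" using e that by (auto simp: dist_real_def)
    from sub[OF this] show ?thesis by (simp add: algebra_simps)
  qed
  ultimately have "d - s = 0"
    using e(1) by (intro DERIV_local_min[of "\<lambda>v. ?H v - s * v" _ t e]) auto
  with d show "(?H has_real_derivative s) (at t)" by simp
qed

lemma conjugate_half_square_0: "conjugate_fun (\<lambda>t. ereal (t\<^sup>2 / 2)) 0 = 0"
proof -
  have "(SUP t::real. ereal (t * 0) - ereal (t\<^sup>2 / 2)) = ereal 0"
  proof (rule SUP_eqI)
    fix y assume "\<And>t::real. t \<in> UNIV \<Longrightarrow> ereal (t * 0) - ereal (t\<^sup>2 / 2) \<le> y"
    from this[of 0] show "ereal 0 \<le> y" by (simp add: zero_ereal_def)
  qed simp
  then show ?thesis by (simp add: conjugate_fun_def)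
qed

section \<open>Quadratic functions\<close>

lemma quad_fun_expand:
  fixes M :: "real^'n^'n"
  assumes "transpose M = M"
  shows "quad_fun M v r y
    = quad_fun M v r x + (M *v x - v) \<bullet> (y - x) + 1/2 * ((y - x) \<bullet> (M *v (y - x)))"
proof -
  have sym: "y \<bullet> (M *v x) = x \<bullet> (M *v y)"
    by (metis assms dot_lmul_matrix inner_commute transpose_matrix_vector)
  show ?thesis unfolding quad_fun_def
    by (simp add: matrix_vector_mult_diff_distrib inner_diff_left inner_diff_right sym
        inner_commute[of "M *v x"] inner_commute[of v] algebra_simps)
qed

lemma quad_fun_GDERIV:
  fixes M :: "real^'n^'n"
  assumes "transpose M = M"
  shows "GDERIV (quad_fun M v r) x :> M *v x - v"
proof -
  have M: "((\<lambda>y. M *v y) has_derivative (\<lambda>h. M *v h)) (at x)"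
    by (rule bounded_linear_imp_has_derivative[OF matrix_vector_mul_bounded_linear])
  have sym: "y \<bullet> (M *v x) = x \<bullet> (M *v y)" for y
    by (metis assms dot_lmul_matrix inner_commute transpose_matrix_vector)
  have "((\<lambda>y. 1/2 * (y \<bullet> (M *v y)) - v \<bullet> y + r) has_derivative
      (\<lambda>h. 1/2 * (x \<bullet> (M *v h) + h \<bullet> (M *v x)) - v \<bullet> h + 0)) (at x)"
    by (intro has_derivative_add has_derivative_diff has_derivative_mult_right
        has_derivative_inner has_derivative_inner_right has_derivative_ident has_derivative_const M)
  moreover have "1/2 * (x \<bullet> (M *v h) + h \<bullet> (M *v x)) - v \<bullet> h + 0 = h \<bullet> (M *v x - v)" for h
    by (simp add: sym[of h] inner_diff_right inner_commute[of v])
  ultimately show ?thesis unfolding gderiv_def quad_fun_def by simp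
qed

lemma transpose_sum: "transpose (\<Sum>k\<in>K. M k) = (\<Sum>k\<in>K. transpose (M k :: real^'n^'m))"
  by (simp add: transpose_def vec_eq_iff)

lemma transpose_add: "transpose (A + B) = transpose A + transpose (B :: real^'n^'m)"
  by (simp add: transpose_def vec_eq_iff)

lemma transpose_Gmat:
  assumes "admissible P"
  shows "transpose (Gmat P \<mu> \<sigma>) = Gmat P \<mu> \<sigma>"
  using assms unfolding Gmat_def admissible_def
  by (simp add: transpose_sum transpose_add transpose_scalar)

lemma matrix_vector_mult_sum:
  "(\<Sum>k\<in>K. M k) *v x = (\<Sum>k\<in>K. (M k :: real^'n^'m) *v x)"
  by (induction K rule: infinite_finite_induct) (auto simp: matrix_vector_mult_add_rdistrib)

lemma Xi_eq_quad_fun: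
  fixes x :: "real^'n::finite"
  shows "Xi P x \<mu> \<sigma> = quad_fun (Gmat P \<mu> \<sigma>) (Fvec P \<mu> \<sigma>)
     (\<Sum>k\<in>UNIV. lam \<mu> k * (ccst P k + \<sigma> $ k * ecst P k
        - real_of_ereal (conjugate_fun (Vfun P k) (\<sigma> $ k)))) x"
proof -
  have summand: "l * (quad_fun A b c x + s * quad_fun C d e x - v)
      = 1/2 * (x \<bullet> ((l *\<^sub>R (A + s *\<^sub>R C)) *v x)) - (l *\<^sub>R (b + s *\<^sub>R d)) \<bullet> x
        + l * (c + s * e - v)"
    for l s c e v :: real and b d and A C :: "real^'n^'n"
    unfolding quad_fun_def
    by (simp add: scaleR_matrix_vector_assoc[symmetric] matrix_vector_mult_add_rdistrib
        inner_add_left inner_add_right) (simp add: algebra_simps)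
  show ?thesis
    unfolding Xi_def qfun_def Lamfun_def summand quad_fun_def[of "Gmat P \<mu> \<sigma>"]
    by (simp add: Gmat_def Fvec_def matrix_vector_mult_sum inner_sum_left inner_sum_right sum_distrib_left
        sum_subtractf sum.distrib)
qed

lemma Xi_GDERIV:
  assumes "admissible P"
  shows "GDERIV (\<lambda>y. Xi P y \<mu> \<sigma>) x :> Gmat P \<mu> \<sigma> *v x - Fvec P \<mu> \<sigma>"
  unfolding Xi_eq_quad_fun by (rule quad_fun_GDERIV[OF transpose_Gmat[OF assms]])

text \<open>
  This gives both comparisons of \<open>Xi\<close> with its stationary value: minimality when the matrix is
  positive semidefinite, strict minimality when it is positive definite.
\<close>

lemma Xi_stationary_expand:
  assumes "admissible P" "Gmat P \<mu> \<sigma> *v x = Fvec P \<mu> \<sigma>"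
  shows "Xi P y \<mu> \<sigma> = Xi P x \<mu> \<sigma> + 1/2 * ((y - x) \<bullet> (Gmat P \<mu> \<sigma> *v (y - x)))"
  unfolding Xi_eq_quad_fun quad_fun_expand[OF transpose_Gmat[OF assms(1)], of \<mu> \<sigma> _ _ y x] assms(2)
  by (simp only: diff_self inner_zero_left add_0_right)

text \<open>
  Two solutions of \<open>G x = F\<close> differ by an element of the kernel of \<open>G\<close>, along which the second-order
  term of the expansion vanishes.
\<close>

lemma Dfun_eq_Xi:
  assumes "admissible P" "Gmat P \<mu> \<sigma> *v x = Fvec P \<mu> \<sigma>"
  shows "Dfun P \<mu> \<sigma> = Xi P x \<mu> \<sigma>"
proof -
  define y where "y = (SOME x. Gmat P \<mu> \<sigma> *v x = Fvec P \<mu> \<sigma>)"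
  have "Gmat P \<mu> \<sigma> *v y = Fvec P \<mu> \<sigma>" unfolding y_def by (rule someI) (rule assms(2))
  then have "Gmat P \<mu> \<sigma> *v (y - x) = 0"
    using assms(2) by (simp add: matrix_vector_mult_diff_distrib)
  then show ?thesis
    using Xi_stationary_expand[OF assms, of y] by (simp add: Dfun_def y_def)
qed

section \<open>Derivatives of the Lagrangians\<close>

text \<open>
  Both Lagrangians are affine in the multiplier, with constant term the summand of index \<open>None\<close>.
\<close>

lemma sum_lam: "(\<Sum>k\<in>UNIV. lam \<mu> k * a k) = a None + (\<Sum>j\<in>UNIV. \<mu> $ j * a (Some j))"
  for \<mu> :: "real^'m::finite"
  by (simp add: UNIV_option_conv sum.reindex lam_def)

lemma lam_GDERIV:
  fixes a :: "'m::finite option \<Rightarrow> real"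
  shows "GDERIV (\<lambda>l. \<Sum>k\<in>UNIV. lam l k * a k) \<mu> :> (\<chi> j. a (Some j))"
proof -
  have "(\<lambda>l. \<Sum>k\<in>UNIV. lam l k * a k) = (\<lambda>l. a None + l \<bullet> (\<chi> j. a (Some j)))"
    by (simp add: sum_lam inner_vec_def)
  then show ?thesis unfolding gderiv_def by (auto intro!: derivative_eq_intros)
qed

lemma lam_partial_deriv:
  fixes a :: "'m::finite option \<Rightarrow> real"
  shows "partial_deriv (\<lambda>l. \<Sum>k\<in>UNIV. lam l k * a k) \<mu> j = a (Some j)"
proof -
  define v where "v = (\<chi> j. a (Some j))"
  have "(\<Sum>k\<in>UNIV. lam (\<mu> + t *\<^sub>R axis j 1) k * a k)
      = a None + \<mu> \<bullet> v + t * a (Some j)" for t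
  proof -
    have "(\<Sum>k\<in>UNIV. lam (\<mu> + t *\<^sub>R axis j 1) k * a k) = a None + (\<mu> + t *\<^sub>R axis j 1) \<bullet> v"
      by (simp add: sum_lam inner_vec_def v_def)
    also have "\<dots> = a None + \<mu> \<bullet> v + t * a (Some j)"
      by (simp add: inner_add_left inner_axis' v_def)
    finally show ?thesis .
  qed
  then show ?thesis unfolding partial_deriv_def
    by (auto intro!: DERIV_imp_deriv derivative_eq_intros)
qed

text \<open>
  The conjugate is not known to be differentiable beforehand.  Along the coordinate \<open>k\<close> of \<open>\<sigma>\<close>, the
  function \<open>Xi\<close> is \<open>- lam \<mu> k\<close> times the conjugate plus an affine function; solving for the
  conjugate yields differentiability together with the value of the derivative.
\<close>

lemma conjugate_deriv_of_Xi_stationary: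
  assumes "GDERIV (\<lambda>s. Xi P x \<mu> s) \<sigma> :> 0" "lam \<mu> k \<noteq> 0"
  shows "((\<lambda>r. real_of_ereal (conjugate_fun (Vfun P k) r)) has_real_derivative Lamfun P k x)
    (at (\<sigma> $ k))"
proof -
  let ?c = "\<lambda>r. real_of_ereal (conjugate_fun (Vfun P k) r)"
  let ?line = "\<lambda>t. \<sigma> + (t - \<sigma> $ k) *\<^sub>R axis k (1::real)"
  have line: "(?line has_derivative (\<lambda>t. t *\<^sub>R axis k 1)) (at (\<sigma> $ k))"
    by (auto intro!: derivative_eq_intros)
  have "((\<lambda>s. Xi P x \<mu> s) has_derivative (\<lambda>h. 0)) (at (?line (\<sigma> $ k)))"
    using assms(1) by (simp add: gderiv_def)
  from has_derivative_compose[OF line this]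
  have X: "((\<lambda>t. Xi P x \<mu> (?line t)) has_real_derivative 0) (at (\<sigma> $ k))"
    by (rule has_derivative_imp_has_field_derivative) simp
  define K where "K = (\<Sum>i\<in>UNIV - {k}. lam \<mu> i *
     (qfun P i x + \<sigma> $ i * Lamfun P i x - real_of_ereal (conjugate_fun (Vfun P i) (\<sigma> $ i))))"
  have "Xi P x \<mu> (?line t) = lam \<mu> k * (qfun P k x + t * Lamfun P k x - ?c t) + K" for t
  proof -
    have comp: "?line t $ i = (if i = k then t else \<sigma> $ i)" for i by (simp add: axis_def)
    show ?thesis unfolding Xi_def K_def comp
      by (subst sum.remove[of _ k]) (auto intro!: sum.cong)
  qed
  then have "?c = (\<lambda>t. qfun P k x + t * Lamfun P k x + (K - Xi P x \<mu> (?line t)) / lam \<mu> k)"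
    using assms(2) by (auto simp: fun_eq_iff field_simps)
  moreover have "((\<lambda>t. qfun P k x + t * Lamfun P k x + (K - Xi P x \<mu> (?line t)) / lam \<mu> k)
      has_real_derivative Lamfun P k x) (at (\<sigma> $ k))"
    by (auto intro!: derivative_eq_intros X simp: assms(2))
  ultimately show ?thesis by simp
qed

lemma interior_Istar_component:
  assumes "\<sigma> \<in> interior (Istar P)"
  shows "\<sigma> $ k \<in> interior (edom (conjugate_fun (Vfun P k)))"
proof -
  obtain e where e: "e > 0" "ball \<sigma> e \<subseteq> Istar P" using assms by (meson mem_interior)
  have "r \<in> edom (conjugate_fun (Vfun P k))" if "r \<in> ball (\<sigma> $ k) e" for r
  proof -
    let ?s = "\<sigma> + (r - \<sigma> $ k) *\<^sub>R axis k 1"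
    have "?s \<in> ball \<sigma> e" using that by (simp add: dist_norm norm_axis_1 abs_minus_commute)
    then have "?s \<in> Istar P" using e(2) by (rule subsetD[rotated])
    then have "?s $ k \<in> edom (conjugate_fun (Vfun P k))"
      unfolding Istar_def mem_Collect_eq by (rule spec)
    then show ?thesis by (simp add: axis_def)
  qed
  then show ?thesis using e(1) by (meson mem_interior subsetI)
qed

text \<open>
  By the chain rule; the interior condition keeps \<open>Vfun P k\<close> finite near the point, so that
  \<open>real_of_ereal\<close> commutes with the sum defining \<open>gfun\<close>.
\<close>

lemma gfun_GDERIV:
  assumes P: "admissible P" and int: "Lamfun P k x \<in> interior (edom (Vfun P k))"
    and D: "((\<lambda>v. real_of_ereal (Vfun P k v)) has_real_derivative s) (at (Lamfun P k x))"
  shows "GDERIV (\<lambda>y. real_of_ereal (gfun P k y)) x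
    :> (Amat P k + s *\<^sub>R Cmat P k) *v x - (bvec P k + s *\<^sub>R dvec P k)"
proof -
  let ?V = "\<lambda>v. real_of_ereal (Vfun P k v)"
  have q: "(qfun P k has_derivative (\<lambda>h. h \<bullet> (Amat P k *v x - bvec P k))) (at x)"
    using quad_fun_GDERIV[of "Amat P k" "bvec P k" "ccst P k" x] P
    by (simp add: admissible_def qfun_def gderiv_def)
  have L: "(Lamfun P k has_derivative (\<lambda>h. h \<bullet> (Cmat P k *v x - dvec P k))) (at x)"
    using quad_fun_GDERIV[of "Cmat P k" "dvec P k" "ecst P k" x] P
    by (simp add: admissible_def Lamfun_def gderiv_def)
  have "((\<lambda>y. ?V (Lamfun P k y)) has_derivative
      (\<lambda>h. s * (h \<bullet> (Cmat P k *v x - dvec P k)))) (at x)"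
    using has_derivative_compose[OF L D[unfolded has_field_derivative_def]] .
  from has_derivative_add[OF q this]
  have sum_deriv: "((\<lambda>y. qfun P k y + ?V (Lamfun P k y)) has_derivative
      (\<lambda>h. h \<bullet> ((Amat P k + s *\<^sub>R Cmat P k) *v x - (bvec P k + s *\<^sub>R dvec P k)))) (at x)"
    by (rule has_derivative_eq_rhs)
      (simp add: fun_eq_iff matrix_vector_mult_add_rdistrib scaleR_matrix_vector_assoc[symmetric]
        inner_add_right inner_diff_right algebra_simps)
  have ev: "\<forall>\<^sub>F y in nhds x.
      qfun P k y + ?V (Lamfun P k y) = real_of_ereal (gfun P k y)"
  proof -
    have "(Lamfun P k \<longlongrightarrow> Lamfun P k x) (at x)"
      using has_derivative_continuous[OF L] by (simp add: isCont_def)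
    then have "\<forall>\<^sub>F y in at x. Lamfun P k y \<in> interior (edom (Vfun P k))"
      using topological_tendstoD[OF _ open_interior int] by blast
    then have "\<forall>\<^sub>F y in nhds x. Lamfun P k y \<in> interior (edom (Vfun P k))"
      using int by (simp add: eventually_nhds_conv_at)
    then show ?thesis
    proof eventually_elim
      case (elim y)
      then have "Lamfun P k y \<in> edom (Vfun P k)" using interior_subset by blast
      moreover have "proper_fun (Vfun P k)"
        using P by (simp add: admissible_def Gamma_sc_proper)
      ultimately have "Vfun P k (Lamfun P k y) = ereal (?V (Lamfun P k y))"
        using proper_ereal_real by metis
      then show ?case unfolding gfun_def by (metis plus_ereal.simps(1) real_of_ereal.simps(1))
    qed
  qed
  show ?thesis unfolding gderiv_def
    by (rule has_derivative_transform_eventually[OF sum_deriv])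
      (use ev eventually_nhds_x_imp_x[OF ev] in \<open>simp_all only: eventually_nhds_conv_at UNIV_I\<close>)
qed

section \<open>Primal and dual values\<close>

lemma admissible_Q:
  assumes "admissible P" "k \<in> Qset P"
  shows "Lamfun P k x = 0" "Vfun P k = (\<lambda>t. ereal (t\<^sup>2 / 2))"
  using assms by (auto simp: admissible_def Lamfun_def quad_fun_def)

lemma gfun_ge:
  assumes "admissible P" "\<sigma> \<in> Istar P"
  shows "ereal (qfun P k x + \<sigma> $ k * Lamfun P k x
      - real_of_ereal (conjugate_fun (Vfun P k) (\<sigma> $ k))) \<le> gfun P k x"
proof -
  have "ereal (qfun P k x) + ereal (Lamfun P k x * \<sigma> $ k
      - real_of_ereal (conjugate_fun (Vfun P k) (\<sigma> $ k))) \<le> gfun P k x"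
    unfolding gfun_def using assms
    by (intro add_left_mono Fenchel_Young Gamma_sc_proper) (auto simp: admissible_def Istar_def)
  then show ?thesis by (simp add: algebra_simps)
qed

lemma Q_term:
  assumes "admissible P" "k \<in> Qset P" "\<sigma> $ k = 0"
  shows "gfun P k x = ereal (qfun P k x + \<sigma> $ k * Lamfun P k x
      - real_of_ereal (conjugate_fun (Vfun P k) (\<sigma> $ k)))"
  using assms(2) by (simp add: assms(3) admissible_Q[OF assms(1,2)] conjugate_half_square_0 Qset_def)

text \<open>
  Each constraint contributes at most 0 to \<open>Xi\<close>.  For \<open>j \<in> J \<inter> Q0set P\<close> the sign of the multiplier
  is unrestricted, but there the summand equals \<open>gfun P (Some j) x = 0\<close>; for the others the
  multiplier is nonnegative and the Fenchel--Young inequality bounds the summand by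
  \<open>gfun P (Some j) x \<le> 0\<close>.
\<close>

lemma Xi_le_ffun:
  assumes P: "admissible P" and x: "x \<in> XJ P (J \<inter> Q0set P)"
    and \<sigma>: "\<sigma> \<in> Istar P" "\<forall>k\<in>Qset P. \<sigma> $ k = 0" and \<mu>: "\<mu> \<in> GammaJ (J \<inter> Q0set P)"
  shows "ereal (Xi P x \<mu> \<sigma>) \<le> ffun P x"
proof -
  let ?a = "\<lambda>k. qfun P k x + \<sigma> $ k * Lamfun P k x
      - real_of_ereal (conjugate_fun (Vfun P k) (\<sigma> $ k))"
  have "\<mu> $ j * ?a (Some j) \<le> 0" for j
  proof (cases "j \<in> J \<inter> Q0set P")
    case True
    then have "gfun P (Some j) x = 0" "Some j \<in> Qset P"
      using x by (auto simp: XJ_def Q0set_def)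
    then have "?a (Some j) = 0"
      using Q_term[OF P, of "Some j" \<sigma> x] \<sigma>(2) by (simp add: zero_ereal_def)
    then show ?thesis by simp
  next
    case False
    then have "gfun P (Some j) x \<le> 0" "0 \<le> \<mu> $ j"
      using x \<mu> by (auto simp: XJ_def GammaJ_def)
    then have "ereal (?a (Some j)) \<le> 0"
      using order_trans[OF gfun_ge[OF P \<sigma>(1), of "Some j" x]] by blast
    with \<open>0 \<le> \<mu> $ j\<close> show ?thesis by (simp add: mult_le_0_iff zero_ereal_def)
  qed
  then have "Xi P x \<mu> \<sigma> \<le> ?a None"
    unfolding Xi_def sum_lam by (simp add: sum_nonpos)
  then have "ereal (Xi P x \<mu> \<sigma>) \<le> ereal (?a None)" by simp
  also have "\<dots> \<le> ffun P x" unfolding ffun_def by (rule gfun_ge[OF P \<sigma>(1)])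
  finally show ?thesis .
qed

lemma weak_duality:
  assumes P: "admissible P" and x: "x \<in> XJ P (J \<inter> Q0set P)"
    and T: "(\<mu>, \<sigma>) \<in> TQcolplus P J"
  shows "ereal (Dfun P \<mu> \<sigma>) \<le> ffun P x"
proof -
  have \<sigma>: "\<sigma> \<in> Istar P" "\<forall>k\<in>Qset P. \<sigma> $ k = 0" and \<mu>: "\<mu> \<in> GammaJ (J \<inter> Q0set P)"
    and psd: "pos_semidef (Gmat P \<mu> \<sigma>)"
    using T by (auto simp: TQcolplus_def TQcol_def Tcol_def)
  obtain y where y: "Gmat P \<mu> \<sigma> *v y = Fvec P \<mu> \<sigma>"
    using T by (auto simp: TQcolplus_def TQcol_def Tcol_def)
  have "Dfun P \<mu> \<sigma> \<le> Xi P x \<mu> \<sigma>"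
    using Xi_stationary_expand[OF P y, of x] psd
    unfolding Dfun_eq_Xi[OF P y] pos_semidef_def by simp
  then show ?thesis using Xi_le_ffun[OF P x \<sigma> \<mu>] by (meson ereal_less_eq(3) order_trans)
qed


theorem proposition11:
  fixes P :: "('n::finite, 'm::finite) cd_data"
    and J :: "'m set"
    and xb :: "real^'n" and lb :: "real^'m" and sb :: "real^('m option)"
  assumes "admissible P"
    and "LKKT_Xi P J xb lb sb"
    and "\<forall>k\<in>Qset P. sb $ k = 0"
  shows
    "(lb \<in> GammaJ J \<and>
      (lb, sb) \<in> TQcol P \<and>
      (\<exists>D. (GDERIV (\<lambda>l. Xi P xb l sb) lb :> D) \<and> lb \<bullet> D = 0) \<and>
      Lfun P xb lb = Xi P xb lb sb \<and>
      (GDERIV (\<lambda>x. Lfun P x lb) xb :> 0) \<and>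
      ffun P xb = ereal (Xi P xb lb sb) \<and>
      Xi P xb lb sb = Dfun P lb sb)
     \<and>
     (- Q0set P \<subseteq> Mneq lb \<longrightarrow>
      (\<exists>D. (GDERIV (\<lambda>l. Lfun P xb l) lb :> D) \<and> (GDERIV (\<lambda>l. Xi P xb l sb) lb :> D)) \<and>
      LKKT_L P J xb lb \<and>
      xb \<in> XJ P (J \<union> - Q0set P))
     \<and>
     ((\<forall>j\<in>- Q0set P. 0 < lb $ j) \<and> pos_semidef (Gmat P lb sb) \<longrightarrow>
      xb \<in> XJ P (J \<union> - Q0set P) \<and>
      XJ P (J \<union> - Q0set P) \<subseteq> XJ P J \<and>
      XJ P J \<subseteq> XJ P (J \<inter> Q0set P) \<and>
      (lb, sb) \<in> TQcolplus P J \<and>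
      ffun P xb = (INF x\<in>XJ P (J \<inter> Q0set P). ffun P x) \<and>
      ffun P xb = ereal (Xi P xb lb sb) \<and>
      Xi P xb lb sb = Lfun P xb lb \<and>
      ereal (Xi P xb lb sb) = (SUP (l, s)\<in>TQcolplus P J. ereal (Dfun P l s)) \<and>
      Xi P xb lb sb = Dfun P lb sb \<and>
      (pos_def (Gmat P lb sb) \<longrightarrow>
        (\<forall>x. global_solution P (J \<inter> Q0set P) x \<longleftrightarrow> x = xb)))"
proof -
  note P = assms(1) and KKT = assms(2) and sQ = assms(3)
  have Vsc: "Vfun P k \<in> Gamma_sc" for k using P by (simp add: admissible_def)
  \<comment> \<open>The summand of \<open>Xi\<close> with index \<open>k\<close> at the given point; for \<open>k = Some j\<close> it is the partial
    derivative in the multiplier \<open>j\<close>.\<close>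
  define a where "a k = qfun P k xb + sb $ k * Lamfun P k xb
      - real_of_ereal (conjugate_fun (Vfun P k) (sb $ k))" for k
  define D where "D = (\<chi> j. a (Some j))"
  have sint: "sb \<in> interior (Istar P)" using KKT by (simp add: LKKT_Xi_def)
  then have sI: "sb \<in> Istar P" using interior_subset by blast
  have Xi_a: "Xi P xb l sb = (\<Sum>k\<in>UNIV. lam l k * a k)" for l
    by (simp add: Xi_def a_def)
  have XiD: "GDERIV (\<lambda>l. Xi P xb l sb) lb :> D"
    unfolding Xi_a D_def by (rule lam_GDERIV)
  have pd: "partial_deriv (\<lambda>l. Xi P xb l sb) lb j = a (Some j)" for j
    unfolding Xi_a by (rule lam_partial_deriv)
  have KJc: "0 \<le> lb $ j" "a (Some j) \<le> 0" "lb $ j * a (Some j) = 0" if "j \<notin> J" for j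
    using KKT that by (simp_all add: LKKT_Xi_def pd)
  have KJ: "a (Some j) = 0" if "j \<in> J" for j
    using KKT that by (simp add: LKKT_Xi_def pd)
  have compl: "lb $ j * a (Some j) = 0" for j
    using KJ KJc(3) by (cases "j \<in> J") auto
  have GF: "Gmat P lb sb *v xb = Fvec P lb sb"
  proof -
    have "GDERIV (\<lambda>y. Xi P y lb sb) xb :> 0" using KKT by (simp add: LKKT_Xi_def)
    then have "(\<lambda>h. h \<bullet> (Gmat P lb sb *v xb - Fvec P lb sb)) = (\<lambda>h. h \<bullet> 0)"
      using Xi_GDERIV[OF P, of lb sb xb] has_derivative_unique unfolding gderiv_def by blast
    then have "(Gmat P lb sb *v xb - Fvec P lb sb) \<bullet> (Gmat P lb sb *v xb - Fvec P lb sb) = 0"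
      by (metis inner_zero_right)
    then show ?thesis by simp
  qed
  \<comment> \<open>Stationarity in \<open>\<sigma>\<close> gives Legendre duality at the indices whose multiplier is
    nonzero; elsewhere \<open>Lamfun P k xb\<close> may even lie outside the domain of \<open>Vfun P k\<close>.\<close>
  have dual: "Vfun P k (Lamfun P k xb) = ereal (Lamfun P k xb * sb $ k
        - real_of_ereal (conjugate_fun (Vfun P k) (sb $ k)))"
      "Lamfun P k xb \<in> interior (edom (Vfun P k))"
      "((\<lambda>v. real_of_ereal (Vfun P k v)) has_real_derivative sb $ k) (at (Lamfun P k xb))"
    if "lam lb k \<noteq> 0" for k
  proof -
    have "GDERIV (\<lambda>s. Xi P xb lb s) sb :> 0" using KKT by (simp add: LKKT_Xi_def)
    from Legendre_duality[OF Vsc interior_Istar_component[OF sint]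
        conjugate_deriv_of_Xi_stationary[OF this that]]
    show "Vfun P k (Lamfun P k xb) = ereal (Lamfun P k xb * sb $ k
        - real_of_ereal (conjugate_fun (Vfun P k) (sb $ k)))"
      "Lamfun P k xb \<in> interior (edom (Vfun P k))"
      "((\<lambda>v. real_of_ereal (Vfun P k v)) has_real_derivative sb $ k) (at (Lamfun P k xb))"
      by blast+
  qed
  have ga: "gfun P k xb = ereal (a k)" if "lam lb k \<noteq> 0 \<or> k \<in> Qset P" for k
  proof (cases "k \<in> Qset P")
    case True
    then show ?thesis unfolding a_def by (rule Q_term[OF P]) (use sQ True in auto)
  next
    case False
    then show ?thesis using dual(1)[of k] that by (simp add: gfun_def a_def algebra_simps)
  qed
  have Leq: "Lfun P xb lb = Xi P xb lb sb"
    unfolding Lfun_def Xi_a by (intro sum.cong refl) (metis ga mult_zero_left real_of_ereal.simps(1))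
  have LG: "GDERIV (\<lambda>x. Lfun P x lb) xb :> 0"
  proof -
    let ?g = "\<lambda>k. (Amat P k + sb $ k *\<^sub>R Cmat P k) *v xb - (bvec P k + sb $ k *\<^sub>R dvec P k)"
    have "((\<lambda>x. lam lb k * real_of_ereal (gfun P k x)) has_derivative
        (\<lambda>h. lam lb k * (h \<bullet> ?g k))) (at xb)" for k
    proof (cases "lam lb k = 0")
      case False
      from gfun_GDERIV[OF P dual(2,3)[OF this]] show ?thesis
        unfolding gderiv_def by (rule has_derivative_mult_right)
    qed simp
    then have "((\<lambda>x. Lfun P x lb) has_derivative
        (\<lambda>h. \<Sum>k\<in>UNIV. lam lb k * (h \<bullet> ?g k))) (at xb)"
      unfolding Lfun_def by (intro has_derivative_sum) auto
    moreover have "(\<Sum>k\<in>UNIV. lam lb k * (h \<bullet> ?g k)) = h \<bullet> (Gmat P lb sb *v xb - Fvec P lb sb)" for h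
      unfolding Gmat_def Fvec_def matrix_vector_mult_sum sum_subtractf[symmetric] inner_sum_right
      by (intro sum.cong refl)
        (simp add: scaleR_matrix_vector_assoc[symmetric] inner_diff_right right_diff_distrib)
    ultimately show ?thesis by (simp add: gderiv_def GF)
  qed
  have fXi: "ffun P xb = ereal (Xi P xb lb sb)"
    using ga[of None] unfolding ffun_def Xi_a sum_lam compl by (simp add: lam_def)
  have XiDf: "Xi P xb lb sb = Dfun P lb sb" by (rule Dfun_eq_Xi[OF P GF, symmetric])
  have Gam: "lb \<in> GammaJ J" using KJc(1) by (auto simp: GammaJ_def)
  have TQ: "(lb, sb) \<in> TQcol P"
    using sI sQ by (simp add: TQcol_def Tcol_def GF[symmetric])
  have "lb \<bullet> D = 0" by (simp add: inner_vec_def D_def compl)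
  with XiD have i: "lb \<in> GammaJ J \<and>
      (lb, sb) \<in> TQcol P \<and>
      (\<exists>D. (GDERIV (\<lambda>l. Xi P xb l sb) lb :> D) \<and> lb \<bullet> D = 0) \<and>
      Lfun P xb lb = Xi P xb lb sb \<and>
      (GDERIV (\<lambda>x. Lfun P x lb) xb :> 0) \<and>
      ffun P xb = ereal (Xi P xb lb sb) \<and>
      Xi P xb lb sb = Dfun P lb sb"
    using Gam TQ Leq LG fXi XiDf by blast
  have ii: "(\<exists>D. (GDERIV (\<lambda>l. Lfun P xb l) lb :> D) \<and> (GDERIV (\<lambda>l. Xi P xb l sb) lb :> D)) \<and>
      LKKT_L P J xb lb \<and>
      xb \<in> XJ P (J \<union> - Q0set P)" if M: "- Q0set P \<subseteq> Mneq lb"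
  proof -
    \<comment> \<open>Now every index either carries duality or belongs to \<open>Qset P\<close>, so the coefficients of
      \<open>Lfun\<close> and \<open>Xi\<close> in the multiplier agree one by one.\<close>
    have nz: "lam lb k \<noteq> 0 \<or> k \<in> Qset P" for k
      using M by (cases k) (auto simp: lam_def Q0set_def Mneq_def)
    have "Lfun P xb = (\<lambda>l. \<Sum>k\<in>UNIV. lam l k * a k)"
      unfolding Lfun_def ga[OF nz] by simp
    then have LXi: "Lfun P xb = (\<lambda>l. Xi P xb l sb)" unfolding Xi_a .
    have "xb \<in> X0set P"
    proof -
      have "Lamfun P k xb \<in> interior (edom (Vfun P k))" for k
      proof (cases "k \<in> Qset P")
        case True
        then show ?thesis by (simp add: admissible_Q[OF P] edom_def)
      next
        case False
        then show ?thesis using nz[of k] dual(2) by blast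
      qed
      then show ?thesis by (simp add: X0set_def)
    qed
    then have LK: "LKKT_L P J xb lb"
      using LG KJ KJc unfolding LKKT_L_def LXi by (simp add: pd)
    have "xb \<in> XJ P (J \<union> - Q0set P)"
    proof -
      have "a (Some j) = 0" if "j \<notin> Q0set P" for j
        using compl[of j] M that by (auto simp: Mneq_def)
      then show ?thesis
        using KJ KJc(2) by (auto simp: XJ_def ga[OF nz] zero_ereal_def)
    qed
    with LK XiD show ?thesis unfolding LXi by blast
  qed
  have iii: "xb \<in> XJ P (J \<union> - Q0set P) \<and>
      XJ P (J \<union> - Q0set P) \<subseteq> XJ P J \<and>
      XJ P J \<subseteq> XJ P (J \<inter> Q0set P) \<and>
      (lb, sb) \<in> TQcolplus P J \<and>
      ffun P xb = (INF x\<in>XJ P (J \<inter> Q0set P). ffun P x) \<and>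
      ffun P xb = ereal (Xi P xb lb sb) \<and>
      Xi P xb lb sb = Lfun P xb lb \<and>
      ereal (Xi P xb lb sb) = (SUP (l, s)\<in>TQcolplus P J. ereal (Dfun P l s)) \<and>
      Xi P xb lb sb = Dfun P lb sb \<and>
      (pos_def (Gmat P lb sb) \<longrightarrow>
        (\<forall>x. global_solution P (J \<inter> Q0set P) x \<longleftrightarrow> x = xb))"
    if pos: "\<forall>j\<in>- Q0set P. 0 < lb $ j" and psd: "pos_semidef (Gmat P lb sb)"
  proof -
    have "- Q0set P \<subseteq> Mneq lb" using pos by (force simp: Mneq_def)
    from ii[OF this] have x1: "xb \<in> XJ P (J \<union> - Q0set P)" by blast
    have mono: "XJ P B \<subseteq> XJ P A" if "A \<subseteq> B" for A B
      using that unfolding XJ_def by (force intro: eq_refl)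
    have x2: "xb \<in> XJ P (J \<inter> Q0set P)" using x1 mono[of "J \<inter> Q0set P" "J \<union> - Q0set P"] by blast
    have Gam': "lb \<in> GammaJ (J \<inter> Q0set P)"
      unfolding GammaJ_def
    proof (intro CollectI ballI)
      fix j assume "j \<in> - (J \<inter> Q0set P)"
      then show "0 \<le> lb $ j" using pos KJc(1)[of j] by (cases "j \<in> J") (auto intro: less_imp_le)
    qed
    have T: "(lb, sb) \<in> TQcolplus P J" using TQ Gam' psd by (simp add: TQcolplus_def)
    have lower: "ereal (Xi P xb lb sb) \<le> ffun P x" if "x \<in> XJ P (J \<inter> Q0set P)" for x
      unfolding XiDf by (rule weak_duality[OF P that T])
    have inf: "ffun P xb = (INF x\<in>XJ P (J \<inter> Q0set P). ffun P x)"
      by (intro antisym INF_greatest INF_lower x2) (simp add: fXi lower)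
    have sup: "ereal (Xi P xb lb sb) = (SUP (l, s)\<in>TQcolplus P J. ereal (Dfun P l s))"
    proof (intro antisym SUP_least)
      show "ereal (Xi P xb lb sb) \<le> (SUP (l, s)\<in>TQcolplus P J. ereal (Dfun P l s))"
        using SUP_upper[OF T, of "\<lambda>(l, s). ereal (Dfun P l s)"] by (simp add: XiDf)
      fix p assume "p \<in> TQcolplus P J"
      then show "(case p of (l, s) \<Rightarrow> ereal (Dfun P l s)) \<le> ereal (Xi P xb lb sb)"
        using weak_duality[OF P x2, of "fst p" "snd p"] by (cases p) (simp add: fXi)
    qed
    have uniq: "global_solution P (J \<inter> Q0set P) x \<longleftrightarrow> x = xb" if pd: "pos_def (Gmat P lb sb)" for x
    proof
      assume "x = xb"
      then show "global_solution P (J \<inter> Q0set P) x"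
        using x2 lower fXi by (auto simp: global_solution_def is_arg_min_def not_less)
    next
      assume x: "global_solution P (J \<inter> Q0set P) x"
      then have xX: "x \<in> XJ P (J \<inter> Q0set P)" and f_le: "ffun P x \<le> ffun P xb"
        using x2 by (auto simp: global_solution_def is_arg_min_def not_less)
      \<comment> \<open>The values of \<open>Xi\<close> at \<open>x\<close> and at its stationary point \<open>xb\<close> differ by half the quadratic
        form of \<open>Gmat P lb sb\<close> at \<open>x - xb\<close>.\<close>
      have "ereal (Xi P x lb sb) \<le> ereal (Xi P xb lb sb)"
        using order_trans[OF Xi_le_ffun[OF P xX sI sQ Gam'] f_le] unfolding fXi .
      then have "(x - xb) \<bullet> (Gmat P lb sb *v (x - xb)) \<le> 0"
        using Xi_stationary_expand[OF P GF, of x] by simp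
      then show "x = xb" using pd unfolding pos_def_def
        by (metis eq_iff_diff_eq_0 not_less)
    qed
    show ?thesis
      using x1 mono[OF Un_upper1] mono[OF Int_lower1] T inf fXi Leq[symmetric] sup XiDf uniq
      by blast
  qed
  show ?thesis using i ii iii by blast
qed

end
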